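(* The eigenvalues of $B=W+(c_1+c_2+\cdots+c_M)\delta$ are $$\lambda_i^b=\lambda_i+\alpha_i\,c_i^{i-1}(0)\quad (1\le i\le M),\qquad \lambda_i^b=\lambda_i\quad (M<i\le\ell+1),$$ where $\lambda_i$ are the eigenvalues of $W$, the vectors $c^{i}_{j}$ are constructed recursively by $c_j^0=c_j$ and $$c_j^i=c_j^{i-1}+\frac{\alpha_i\,c_j^{i-1}(0)}{\lambda_j-\lambda_i-\alpha_i\,c_i^{i-1}(0)}\,c_i^{i-1}\qquad(i<j\le M),$$ and, for each $i=1,\ldots,M$, $\alpha_i$ is a (possibly non-real) solution of $$1-\alpha_i=\alpha_i\sum_{j=i+1}^M\frac{c_j^{i-1}(0)}{\lambda_j-\lambda_i-\alpha_i\,c_i^{i-1}(0)} .$$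
   Context: Let $\ell$ be finite; matrices are $(\ell+1)\times(\ell+1)$ with indices $0,\ldots,\ell$, and $\delta$ is the row vector with $\delta(0)=1$ and $0$ elsewhere. $B$ has the following form: for non-negative reals $b_i^d,b_i^u,b_i^z$ with $b_0^d>0$, $b_\ell^u=0$ and $b_i^w=b_i^z+b_i^d+b_i^u>0$, one has $B(0,0)=-b_0^d-b_0^u$, $B(0,1)=b_0^u$; $B(1,0)=b_1^d+b_1^z$, $B(1,1)=-b_1^w$, $B(1,2)=b_1^u$; for $i\ge2$: $B(i,0)=b_i^z$, $B(i,i-1)=b_i^d$, $B(i,i)=-b_i^w$, and $B(i,i+1)=b_i^u$ if $i<\ell$; other entries $0$. $W=(w_{ij})$ is a real tridiagonal matrix that coincides with $B$ outside the first column, with $w_{i,i-1}w_{i-1,i}>0$ for all $1\le i\le\ell$, $w_{ii}<0$, and eigenvalues $\lambda_1,\ldots,\lambda_{\ell+1}$ that are negative, real and distinct. The corresponding eigenvectors $c_1,\ldots,c_{\ell+1}$ are a basis and have non-zero first entry $c_i(0)$. The first column of $B-W$ is expanded in eigenvectors of $W$; after reordering and rescaling the eigenvectors so that precisely the first $M$ occur with coefficient $1$, one has $B=W+(c_1+\cdots+c_M)\delta$, where $c_i\delta$ is the matrix with first column $c_i$ and other columns zero. *)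

theory Defs
  imports "Jordan_Normal_Form.Char_Poly"
begin

text \<open>The case \<open>i = 1\<close> is separate because there the down-rate \<open>bd 1\<close> and the rate
  \<open>bz 1\<close> back to \<open>0\<close> fall on the same entry.\<close>

definition B_matrix :: "nat \<Rightarrow> (nat \<Rightarrow> real) \<Rightarrow> (nat \<Rightarrow> real) \<Rightarrow> (nat \<Rightarrow> real) \<Rightarrow> real mat" where
  "B_matrix l bd bu bz = mat (l + 1) (l + 1) (\<lambda>(i, j).
     if i = 0 then
       (if j = 0 then - bd 0 - bu 0 else if j = 1 then bu 0 else 0)
     else if i = 1 then
       (if j = 0 then bd 1 + bz 1
        else if j = 1 then - (bz 1 + bd 1 + bu 1)
        else if j = 2 then bu 1 else 0)
     else
       (if j = 0 then bz i
        else if j = i - 1 then bd i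
        else if j = i then - (bz i + bd i + bu i)
        else if j = i + 1 then bu i else 0))"

text \<open>The product of the column vector \<open>v\<close> with the row vector \<open>\<delta> = (1, 0, \<dots>, 0)\<close>.\<close>

definition times_delta :: "'a :: zero vec \<Rightarrow> 'a mat" where
  "times_delta v = mat (dim_vec v) (dim_vec v) (\<lambda>(i, j). if j = 0 then v $ i else 0)"

text \<open>\<open>cvec lam c \<alpha> i j\<close> is $c_j^i$; it is meaningful only for \<open>i < j\<close>, and its values
  for \<open>j \<le> i\<close> are never used below.\<close>

primrec cvec :: "(nat \<Rightarrow> real) \<Rightarrow> (nat \<Rightarrow> real vec) \<Rightarrow> (nat \<Rightarrow> complex) \<Rightarrow>
    nat \<Rightarrow> nat \<Rightarrow> complex vec" where
  "cvec lam c \<alpha> 0 = (\<lambda>j. map_vec complex_of_real (c j))"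
| "cvec lam c \<alpha> (Suc i) = (\<lambda>j. cvec lam c \<alpha> i j +
     (\<alpha> (Suc i) * cvec lam c \<alpha> i j $ 0 /
       (complex_of_real (lam j) - complex_of_real (lam (Suc i))
         - \<alpha> (Suc i) * cvec lam c \<alpha> i (Suc i) $ 0))
     \<cdot>\<^sub>v cvec lam c \<alpha> i (Suc i))"

text \<open>\<open>\<alpha> i\<close> solves the \<open>i\<close>-th equation. Since \<open>x / 0 = 0\<close>, the requirement that no
  denominator vanishes has to be stated explicitly.\<close>

definition alpha_solves :: "nat \<Rightarrow> (nat \<Rightarrow> real) \<Rightarrow> (nat \<Rightarrow> real vec) \<Rightarrow> (nat \<Rightarrow> complex) \<Rightarrow>
    nat \<Rightarrow> bool" where
  "alpha_solves M lam c \<alpha> i \<longleftrightarrow>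
     (\<forall>j\<in>{i+1..M}. complex_of_real (lam j) - complex_of_real (lam i)
        - \<alpha> i * cvec lam c \<alpha> (i - 1) i $ 0 \<noteq> 0) \<and>
     1 - \<alpha> i = \<alpha> i * (\<Sum>j=i+1..M. cvec lam c \<alpha> (i - 1) j $ 0 /
        (complex_of_real (lam j) - complex_of_real (lam i)
          - \<alpha> i * cvec lam c \<alpha> (i - 1) i $ 0))"

definition lam_b :: "nat \<Rightarrow> (nat \<Rightarrow> real) \<Rightarrow> (nat \<Rightarrow> real vec) \<Rightarrow> (nat \<Rightarrow> complex) \<Rightarrow>
    nat \<Rightarrow> complex" where
  "lam_b M lam c \<alpha> i =
     (if i \<le> M then complex_of_real (lam i) + \<alpha> i * cvec lam c \<alpha> (i - 1) i $ 0
      else complex_of_real (lam i))"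

end

theory Submission imports Defs begin

text \<open>
  Subtracting \<open>(c\<^sub>1 + \<dots> + c\<^sub>M) \<delta>\<close> from \<open>x I - W\<close> alters only the first column, and a determinant is
  linear in that column. Since \<open>(x I - W) c\<^sub>j = (x - \<lambda>\<^sub>j) c\<^sub>j\<close>, Cramer's rule gives
  \<open>(x - \<lambda>\<^sub>j) D\<^sub>j = c\<^sub>j(0) det (x I - W)\<close>, where \<open>D\<^sub>j\<close> is the determinant of \<open>x I - W\<close> with \<open>c\<^sub>j\<close>
  put into the first column. As \<open>det (x I - W) = \<Prod>\<^sub>k (x - \<lambda>\<^sub>k)\<close>, the characteristic polynomial of
  \<open>B\<close> is the product of the factors \<open>x - \<lambda>\<^sub>k\<close> with \<open>k > M\<close> and of the secular polynomial
  \<open>\<Prod>\<^sub>k (x - \<lambda>\<^sub>k) - \<Sum>\<^sub>j p\<^sub>j \<Prod>\<^sub>k\<^sub>\<noteq>\<^sub>j (x - \<lambda>\<^sub>k)\<close> with nodes \<open>\<lambda>\<^sub>1, \<dots>, \<lambda>\<^sub>M\<close> and weights \<open>p\<^sub>j = c\<^sub>j(0)\<close>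
  (\<open>char_poly_first_column_perturbation\<close>). Only the first entries of the vectors matter from here
  on, and the recursion for \<open>c\<^sub>j\<^sup>i\<close> becomes a recursion for the weights.

  That recursion is deflation. If \<open>\<alpha>\<close> solves the equation for the node \<open>\<lambda>\<^sub>i\<close>, then
  \<open>\<mu> = \<lambda>\<^sub>i + \<alpha> p\<^sub>i\<close> is a root of the secular polynomial, and the quotient by \<open>x - \<mu>\<close> is the secular
  polynomial on the other nodes with weights \<open>p\<^sub>j (\<lambda>\<^sub>j - \<lambda>\<^sub>i) / (\<lambda>\<^sub>j - \<mu>)\<close>, which are
  the first entries of the updated vectors (\<open>secular_poly_deflate\<close>). Deflating \<open>M\<close> times splits
  the secular polynomial into the factors \<open>x - \<lambda>\<^sub>i\<^sup>b\<close>, with multiplicities.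

  Solutions exist because the complex secular polynomial has a root. When the nodes are distinct
  and the weights nonzero, no root is a node, so a root \<open>\<mu>\<close> gives the admissible
  \<open>\<alpha> = (\<mu> - \<lambda>\<^sub>i) / p\<^sub>i\<close> (\<open>ex_deflating_alpha\<close>). The formula for the new weights shows
  that they are nonzero again, and the initial ones are nonzero because an eigenvector of a
  tridiagonal matrix with nonzero superdiagonal is determined by its eigenvalue and its first entry.
\<close>

section \<open>Secular polynomials\<close>

text \<open>This is \<open>\<Prod>k\<in>S. (x - lam k)\<close> times the secular function \<open>1 - (\<Sum>j\<in>S. p j / (x - lam j))\<close> of a
  rank-one perturbation, with denominators cleared so that it makes sense at the nodes too.\<close>

definition secular_poly :: "'b set \<Rightarrow> ('b \<Rightarrow> 'a :: field) \<Rightarrow> ('b \<Rightarrow> 'a) \<Rightarrow> 'a poly" where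
  "secular_poly S lam p = (\<Prod>k\<in>S. [:- lam k, 1:]) -
     (\<Sum>j\<in>S. Polynomial.smult (p j) (\<Prod>k\<in>S - {j}. [:- lam k, 1:]))"

lemma secular_poly_empty [simp]: "secular_poly {} lam p = 1"
  by (simp add: secular_poly_def)

lemma secular_poly_cong:
  assumes "\<And>j. j \<in> S \<Longrightarrow> p j = q j"
  shows "secular_poly S lam p = secular_poly S lam q"
  using assms by (simp add: secular_poly_def)

text \<open>Write \<open>L k\<close> for the linear factor of node \<open>k\<close>, \<open>G\<close> for the product of these over \<open>S\<close>, and
  \<open>H j = G / L j\<close>. The hypothesis on \<open>q\<close> says \<open>q j * d j = p j * (lam j - lam i)\<close>, which makes the
  terms with \<open>H j\<close> on both sides agree up to a multiple of \<open>G\<close>. What is left is a single scalar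
  times \<open>G\<close>, and the equation for \<open>a\<close> says that this scalar is zero.\<close>

lemma secular_poly_deflate:
  fixes lam p q :: "'b \<Rightarrow> 'a :: field" and a :: 'a and i :: 'b
  defines "d j \<equiv> lam j - lam i - a * p i"
  assumes S: "finite S" "i \<notin> S"
    and d: "\<And>j. j \<in> S \<Longrightarrow> d j \<noteq> 0"
    and a: "1 - a = a * (\<Sum>j\<in>S. p j / d j)"
    and q: "\<And>j. j \<in> S \<Longrightarrow> q j = p j + a * p j / d j * p i"
  shows "secular_poly (insert i S) lam p =
    [:- (lam i + a * p i), 1:] * secular_poly S lam q"
proof -
  let ?L = "\<lambda>k. [:- lam k, 1:]" and ?M = "[:- (lam i + a * p i), 1:]"
  define G where "G = (\<Prod>k\<in>S. ?L k)"
  define H where "H j = (\<Prod>k\<in>S - {j}. ?L k)" for j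
  have GH: "G = ?L j * H j" if "j \<in> S" for j
    using that S by (simp add: G_def H_def prod.remove)
  have "(\<Prod>k\<in>insert i S - {j}. ?L k) = ?L i * H j" if "j \<in> S" for j
  proof -
    have "insert i S - {j} = insert i (S - {j})" using that S by auto
    then show ?thesis using S by (simp add: H_def del: mult_pCons_left)
  qed
  then have "secular_poly (insert i S) lam p =
      ?L i * G - (Polynomial.smult (p i) G + (\<Sum>j\<in>S. Polynomial.smult (p j) (?L i * H j)))"
    using S by (simp add: secular_poly_def G_def del: mult_pCons_left)
  moreover have "?M * secular_poly S lam q = ?M * G - (\<Sum>j\<in>S. Polynomial.smult (q j) (?M * H j))"
    by (simp add: secular_poly_def G_def H_def right_diff_distrib sum_distrib_left del: mult_pCons_left)
  moreover have "Polynomial.smult (q j) (?M * H j) =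
      Polynomial.smult (p j) (?L i * H j) + Polynomial.smult (q j - p j) G" if j: "j \<in> S" for j
  proof -
    \<comment> \<open>Both sides of the identity below for linear polynomials have the same value at \<open>lam j\<close>
      precisely because of this equation.\<close>
    have "q j * d j = p j * (lam j - lam i)"
      using d[OF j] by (simp add: q[OF j] field_simps) (simp add: d_def algebra_simps)
    then have "Polynomial.smult (q j) ?M = Polynomial.smult (p j) (?L i) + Polynomial.smult (q j - p j) (?L j)"
      by (simp add: d_def algebra_simps)
    then have "Polynomial.smult (q j) ?M * H j =
        (Polynomial.smult (p j) (?L i) + Polynomial.smult (q j - p j) (?L j)) * H j"
      by (rule arg_cong)
    then show ?thesis
      by (simp only: GH[OF j] distrib_right mult_smult_left)
  qed
  moreover have "?M * G = ?L i * G - Polynomial.smult (a * p i) G"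
    by (simp add: algebra_simps smult_diff_left smult_add_left)
  moreover have "(\<Sum>j\<in>S. Polynomial.smult (q j - p j) G) = Polynomial.smult (p i - a * p i) G"
  proof -
    have "(\<Sum>j\<in>S. q j - p j) = p i * (a * (\<Sum>j\<in>S. p j / d j))"
      by (simp add: q sum_distrib_left algebra_simps)
    also have "\<dots> = p i - a * p i" unfolding a[symmetric] by (simp add: algebra_simps)
    finally show ?thesis by (simp add: smult_sum[symmetric])
  qed
  ultimately show ?thesis
    by (simp add: sum.distrib smult_diff_left del: mult_pCons_left)
qed

text \<open>Only the summand that omits the factor of node \<open>i\<close> survives at that node, so a secular polynomial
  with distinct nodes and nonzero weights does not vanish at any node.\<close>

lemma poly_secular_poly_at_node:
  assumes "finite S" "i \<in> S"
  shows "poly (secular_poly S lam p) (lam i) = - p i * (\<Prod>k\<in>S - {i}. lam i - lam k)"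
proof -
  have "(\<Sum>j\<in>S. p j * (\<Prod>k\<in>S - {j}. lam i - lam k)) =
      (\<Sum>j\<in>S. if j = i then p i * (\<Prod>k\<in>S - {i}. lam i - lam k) else 0)"
    using assms by (intro sum.cong) auto
  then show ?thesis using assms by (auto simp: secular_poly_def poly_prod poly_sum)
qed

lemma degree_secular_poly:
  assumes "finite S" "S \<noteq> {}"
  shows "degree (secular_poly S lam p) = card S"
proof -
  have "degree (\<Sum>j\<in>S. Polynomial.smult (p j) (\<Prod>k\<in>S - {j}. [:- lam k, 1:])) < card S"
  proof (rule degree_sum_less)
    fix j assume j: "j \<in> S"
    have "degree (\<Prod>k\<in>S - {j}. [:- lam k, 1:]) = card (S - {j})"
      by (subst degree_prod_eq_sum_degree) auto
    then show "degree (Polynomial.smult (p j) (\<Prod>k\<in>S - {j}. [:- lam k, 1:])) < card S"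
      using j assms card_gt_0_iff[of S] by (auto intro: le_less_trans[OF degree_smult_le])
  qed (use assms card_gt_0_iff[of S] in auto)
  moreover have "degree (\<Prod>k\<in>S. [:- lam k, 1:]) = card S"
    by (subst degree_prod_eq_sum_degree) auto
  ultimately show ?thesis
    unfolding secular_poly_def diff_conv_add_uminus
    by (subst degree_add_eq_left) auto
qed

text \<open>For nonzero \<open>a\<close>, the equation for \<open>a\<close> is the secular equation \<open>(\<Sum>j\<in>insert i S. p j / (m - lam j)) = 1\<close>
  in the variable \<open>m = lam i + a * p i\<close>, multiplied by \<open>a\<close>. The fundamental theorem of algebra supplies
  a root \<open>m\<close>; the hypotheses keep it away from all nodes, hence the denominators away from zero.\<close>

lemma ex_deflating_alpha:
  fixes lam p :: "'b \<Rightarrow> complex"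
  assumes S: "finite S" "i \<notin> S" and inj: "inj_on lam (insert i S)"
    and p: "\<And>j. j \<in> insert i S \<Longrightarrow> p j \<noteq> 0"
  shows "\<exists>a. (\<forall>j\<in>S. lam j - lam i - a * p i \<noteq> 0) \<and>
    1 - a = a * (\<Sum>j\<in>S. p j / (lam j - lam i - a * p i))"
proof -
  have "\<not> constant (poly (secular_poly (insert i S) lam p))"
    using S by (simp add: constant_degree degree_secular_poly)
  then obtain m where m: "poly (secular_poly (insert i S) lam p) m = 0"
    using fundamental_theorem_of_algebra by blast
  have m_ne: "m \<noteq> lam j" if j: "j \<in> insert i S" for j
  proof
    assume "m = lam j"
    then have "- p j * (\<Prod>k\<in>insert i S - {j}. lam j - lam k) = 0"
      using m poly_secular_poly_at_node[of "insert i S" j lam p] S j by simp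
    then have "\<exists>k\<in>insert i S - {j}. lam j = lam k"
      using p[OF j] S by simp
    then show False using inj j by (metis DiffD1 DiffD2 inj_onD insertI1)
  qed
  define G where "G = (\<Prod>k\<in>insert i S. m - lam k)"
  have G: "G \<noteq> 0" using m_ne S by (auto simp: G_def)
  have rest: "(\<Prod>k\<in>insert i S - {j}. m - lam k) = G / (m - lam j)" if "j \<in> insert i S" for j
    using m_ne[OF that] S that unfolding G_def by (subst prod.remove[of _ j]) auto
  have "G = (\<Sum>j\<in>insert i S. p j * (\<Prod>k\<in>insert i S - {j}. m - lam k))"
    using m unfolding G_def secular_poly_def by (simp only: poly_diff poly_sum poly_smult poly_prod) simp
  also have "\<dots> = (\<Sum>j\<in>insert i S. G * (p j / (m - lam j)))"
    by (intro sum.cong) (simp_all only: rest, simp)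
  also have "\<dots> = G * (\<Sum>j\<in>insert i S. p j / (m - lam j))"
    by (simp only: sum_distrib_left)
  finally have sec: "(\<Sum>j\<in>insert i S. p j / (m - lam j)) = 1"
    using G by simp
  define a where "a = (m - lam i) / p i"
  have d: "lam j - lam i - a * p i = - (m - lam j)" for j
    using p[of i] by (simp add: a_def)
  have "(\<Sum>j\<in>S. p j / (lam j - lam i - a * p i)) = - (\<Sum>j\<in>S. p j / (m - lam j))"
    unfolding d by (simp only: divide_minus_right sum_negf)
  then have "1 = p i / (m - lam i) - (\<Sum>j\<in>S. p j / (lam j - lam i - a * p i))"
    using sec S by simp
  then have "a * 1 = a * (p i / (m - lam i) - (\<Sum>j\<in>S. p j / (lam j - lam i - a * p i)))"
    by simp
  moreover have "a * (p i / (m - lam i)) = 1"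
    using p[of i] m_ne[of i] by (simp add: a_def)
  ultimately have "1 - a = a * (\<Sum>j\<in>S. p j / (lam j - lam i - a * p i))"
    by (simp only: right_diff_distrib mult_1_right) (simp only: diff_eq_eq eq_diff_eq add.commute)
  moreover have "\<forall>j\<in>S. lam j - lam i - a * p i \<noteq> 0"
    using m_ne unfolding d by force
  ultimately show ?thesis by blast
qed

section \<open>Perturbing the first column\<close>

text \<open>Both sides are monic of degree \<open>n\<close> and vanish at the same \<open>n\<close> points.\<close>

lemma char_poly_distinct_eigenvalues:
  fixes A :: "'a :: field mat"
  assumes A: "A \<in> carrier_mat n n"
    and ev: "\<And>i. i \<in> I \<Longrightarrow> eigenvalue A (lam i)"
    and inj: "inj_on lam I" and I: "finite I" "card I = n"
  shows "char_poly A = (\<Prod>i\<in>I. [:- lam i, 1:])"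
proof (rule poly_eqI_degree_lead_coeff[where n = n and A = "lam ` I"])
  have deg: "degree (\<Prod>i\<in>I. [:- lam i, 1:]) = n"
    by (subst degree_prod_eq_sum_degree) (use I in auto)
  have "lead_coeff (\<Prod>i\<in>I. [:- lam i, 1:]) = 1"
    by (simp add: lead_coeff_prod)
  with deg show "coeff (char_poly A) n = coeff (\<Prod>i\<in>I. [:- lam i, 1:]) n"
    using degree_monic_char_poly[OF A] by simp
  show "degree (\<Prod>i\<in>I. [:- lam i, 1:]) \<le> n" using deg by simp
  show "degree (char_poly A) \<le> n" using degree_monic_char_poly[OF A] by simp
  show "n \<le> card (lam ` I)" using card_image[OF inj] I by simp
  show "poly (char_poly A) z = poly (\<Prod>i\<in>I. [:- lam i, 1:]) z" if "z \<in> lam ` I" for z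
    using that ev I eigenvalue_root_char_poly[OF A] by (auto simp: poly_prod)
qed

text \<open>The cofactors along a column do not depend on that column. This gives linearity of the
  determinant in the column, and a scalar can be moved in and out of it.\<close>

lemma det_replace_col_expand:
  fixes A :: "'a :: comm_ring_1 mat"
  assumes A: "A \<in> carrier_mat n n" and k: "k < n"
  shows "det (replace_col A v k) = (\<Sum>i<n. v $ i * cofactor A i k)"
proof -
  have R: "replace_col A v k \<in> carrier_mat n n"
    using A by (auto simp: replace_col_def)
  have "mat_delete (replace_col A v k) i k = mat_delete A i k" for i
    using A by (intro eq_matI) (auto simp: mat_delete_def replace_col_def)
  then show ?thesis
    using A k by (subst laplace_expansion_column[OF R k])
      (auto simp: cofactor_def replace_col_def intro!: sum.cong)
qed

text \<open>The eigenvalue equation \<open>(x I - A) v = (x - e) v\<close> for the indeterminate \<open>x\<close>, so that Cramer's rule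
  can be applied over the polynomial ring, where \<open>x - e\<close> may be cancelled.\<close>

lemma char_poly_matrix_eigenvector:
  fixes A :: "'a :: comm_ring_1 mat"
  assumes A: "A \<in> carrier_mat n n" and ev: "eigenvector A v e"
  shows "char_poly_matrix A *\<^sub>v map_vec (\<lambda>a. [:a:]) v = [:- e, 1:] \<cdot>\<^sub>v map_vec (\<lambda>a. [:a:]) v"
proof (rule eq_vecI)
  have v: "v \<in> carrier_vec n" and Av: "A *\<^sub>v v = e \<cdot>\<^sub>v v"
    using A ev by (auto simp: eigenvector_def)
  fix i assume "i < dim_vec ([:- e, 1:] \<cdot>\<^sub>v map_vec (\<lambda>a. [:a:]) v)"
  then have i: "i < n" using v by simp
  have "(\<Sum>j<n. A $$ (i, j) * v $ j) = e * v $ i"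
    using arg_cong[OF Av, of "\<lambda>w. w $ i"] A v i
    by (simp add: scalar_prod_def atLeast0LessThan)
  then have "[:\<Sum>j<n. A $$ (i, j) * v $ j:] = [:e * v $ i:]" by simp
  then have Avi: "(\<Sum>j<n. [:A $$ (i, j) * v $ j:]) = [:e * v $ i:]"
    by (simp add: sum_to_poly)
  have "(char_poly_matrix A *\<^sub>v map_vec (\<lambda>a. [:a:]) v) $ i =
      (\<Sum>j<n. (if i = j then [:0, v $ j:] else 0) - [:A $$ (i, j) * v $ j:])"
    using A v i by (auto simp: char_poly_matrix_def scalar_prod_def atLeast0LessThan algebra_simps
        intro!: sum.cong)
  also have "\<dots> = [:0, v $ i:] - [:e * v $ i:]"
    using i by (simp add: sum_subtractf Avi)
  finally show "(char_poly_matrix A *\<^sub>v map_vec (\<lambda>a. [:a:]) v) $ i =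
      ([:- e, 1:] \<cdot>\<^sub>v map_vec (\<lambda>a. [:a:]) v) $ i"
    using v i by (simp add: mult.commute)
qed (use A ev in \<open>auto simp: eigenvector_def char_poly_matrix_def\<close>)

text \<open>The determinant of \<open>x I - A\<close> is expanded along the first column. Each \<open>c j\<close> contributes the
  determinant with \<open>c j\<close> in that column, which Cramer's rule evaluates because \<open>c j\<close> is an
  eigenvector. The indices outside \<open>J\<close> never lose their factor, so the product over \<open>I - J\<close>
  can be taken out.\<close>

lemma char_poly_first_column_perturbation:
  fixes A :: "'a :: field mat"
  assumes A: "A \<in> carrier_mat n n" and n: "0 < n"
    and ev: "\<And>i. i \<in> I \<Longrightarrow> eigenvector A (c i) (lam i)"
    and inj: "inj_on lam I" and I: "finite I" "card I = n" and J: "J \<subseteq> I"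
    and v: "v \<in> carrier_vec n" "\<And>k. k < n \<Longrightarrow> v $ k = (\<Sum>j\<in>J. c j $ k)"
  shows "char_poly (A + times_delta v) =
    (\<Prod>k\<in>I - J. [:- lam k, 1:]) * secular_poly J lam (\<lambda>j. c j $ 0)"
proof -
  let ?X = "char_poly_matrix A" and ?C = "\<lambda>j. map_vec (\<lambda>a. [:a:]) (c j)"
  let ?L = "\<lambda>k. [:- lam k, 1:]"
  have X: "?X \<in> carrier_mat n n" using A by simp
  have B: "A + times_delta v \<in> carrier_mat n n" using A v by (simp add: times_delta_def)
  have fJ: "finite J" using J I finite_subset by blast
  have c: "c j \<in> carrier_vec n" if "j \<in> J" for j
    using ev[of j] that J A by (auto simp: eigenvector_def)
  have char_A: "det ?X = (\<Prod>k\<in>I. ?L k)"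
  proof -
    have "eigenvalue A (lam i)" if "i \<in> I" for i
      using ev[OF that] by (auto simp: eigenvalue_def)
    then show ?thesis
      using char_poly_distinct_eigenvalues[OF A _ inj I] by (simp add: char_poly_def)
  qed
  have det_C: "det (replace_col ?X (?C j) 0) = Polynomial.smult (c j $ 0) (\<Prod>k\<in>I - {j}. ?L k)"
    if j: "j \<in> J" for j
  proof -
    have "?L j * det (replace_col ?X (?C j) 0) = det (replace_col ?X (?L j \<cdot>\<^sub>v ?C j) 0)"
      using c[OF j] by (simp only: det_replace_col_expand[OF X n])
        (auto simp: sum_distrib_left mult.assoc simp del: mult_pCons_left intro!: sum.cong)
    also have "?L j \<cdot>\<^sub>v ?C j = ?X *\<^sub>v ?C j"
      using char_poly_matrix_eigenvector[OF A ev] j J by auto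
    also have "det (replace_col ?X (?X *\<^sub>v ?C j) 0) = ?C j $ 0 * det ?X"
      by (rule cramer_lemma_mat[OF X _ n]) (use c[OF j] in auto)
    also have "\<dots> = ?L j * Polynomial.smult (c j $ 0) (\<Prod>k\<in>I - {j}. ?L k)"
      using c[OF j] n j J I by (subst char_A, subst prod.remove[of _ j]) auto
    finally show ?thesis by (subst (asm) mult_cancel_left) simp
  qed
  have "char_poly (A + times_delta v) = det ?X - (\<Sum>j\<in>J. det (replace_col ?X (?C j) 0))"
  proof -
    let ?Y = "char_poly_matrix (A + times_delta v)"
    have Y: "?Y \<in> carrier_mat n n" using B by simp
    have del: "mat_delete ?Y i 0 = mat_delete ?X i 0" for i
      using A v by (intro eq_matI)
        (auto simp: mat_delete_def char_poly_matrix_def times_delta_def)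
    have col: "?Y $$ (i, 0) = ?X $$ (i, 0) - (\<Sum>j\<in>J. ?C j $ i)" if "i < n" for i
    proof -
      have "(\<Sum>j\<in>J. ?C j $ i) = (\<Sum>j\<in>J. [:c j $ i:])"
        using carrier_vecD[OF c] that by (intro sum.cong) simp_all
      also have "\<dots> = [:v $ i:]" using v that by (simp add: sum_to_poly)
      finally show ?thesis
        using A v that n by (simp add: char_poly_matrix_def times_delta_def)
    qed
    have "det ?Y = (\<Sum>i<n. (?X $$ (i, 0) - (\<Sum>j\<in>J. ?C j $ i)) * cofactor ?X i 0)"
      by (subst laplace_expansion_column[OF Y n])
        (auto simp: cofactor_def del col intro!: sum.cong)
    also have "\<dots> = det ?X - (\<Sum>i<n. \<Sum>j\<in>J. ?C j $ i * cofactor ?X i 0)"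
      by (simp add: laplace_expansion_column[OF X n] left_diff_distrib sum_subtractf sum_distrib_right)
    also have "(\<Sum>i<n. \<Sum>j\<in>J. ?C j $ i * cofactor ?X i 0) =
        (\<Sum>j\<in>J. det (replace_col ?X (?C j) 0))"
      by (subst sum.swap) (simp add: det_replace_col_expand[OF X n])
    finally show ?thesis by (simp add: char_poly_def)
  qed
  also have "\<dots> = (\<Prod>k\<in>I. ?L k) - (\<Sum>j\<in>J. Polynomial.smult (c j $ 0) (\<Prod>k\<in>I - {j}. ?L k))"
    using det_C char_A by simp
  also have "(\<Prod>k\<in>I. ?L k) = (\<Prod>k\<in>I - J. ?L k) * (\<Prod>k\<in>J. ?L k)"
    by (rule prod.subset_diff[OF J I(1)])
  also have "(\<Sum>j\<in>J. Polynomial.smult (c j $ 0) (\<Prod>k\<in>I - {j}. ?L k)) =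
      (\<Sum>j\<in>J. (\<Prod>k\<in>I - J. ?L k) * Polynomial.smult (c j $ 0) (\<Prod>k\<in>J - {j}. ?L k))"
  proof (rule sum.cong[OF refl])
    fix j assume j: "j \<in> J"
    have "(\<Prod>k\<in>I - {j}. ?L k) = (\<Prod>k\<in>I - {j} - (J - {j}). ?L k) * (\<Prod>k\<in>J - {j}. ?L k)"
      by (rule prod.subset_diff) (use J I in auto)
    also have "I - {j} - (J - {j}) = I - J" using j by auto
    finally show "Polynomial.smult (c j $ 0) (\<Prod>k\<in>I - {j}. ?L k) =
        (\<Prod>k\<in>I - J. ?L k) * Polynomial.smult (c j $ 0) (\<Prod>k\<in>J - {j}. ?L k)"
      by simp
  qed
  finally show ?thesis
    by (simp add: secular_poly_def right_diff_distrib sum_distrib_left)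
qed

section \<open>First entries of eigenvectors\<close>

text \<open>Row \<open>i\<close> of the eigenvalue equation expresses the superdiagonal entry of row \<open>i\<close> times \<open>v $ (i + 1)\<close>
  through the entries of \<open>v\<close> up to \<open>i\<close>. If \<open>v $ 0\<close> were zero, all of \<open>v\<close> would vanish.\<close>

lemma lower_hessenberg_eigenvector_head_nonzero:
  fixes A :: "'a :: field mat"
  assumes A: "A \<in> carrier_mat (l + 1) (l + 1)"
    and tri: "\<And>i j. i \<le> l \<Longrightarrow> j \<le> l \<Longrightarrow> i + 1 < j \<Longrightarrow> A $$ (i, j) = 0"
    and super: "\<And>i. i < l \<Longrightarrow> A $$ (i, i + 1) \<noteq> 0"
    and ev: "eigenvector A v e"
  shows "v $ 0 \<noteq> 0"
proof
  assume v0: "v $ 0 = 0"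
  have v: "v \<in> carrier_vec (l + 1)" "v \<noteq> 0\<^sub>v (l + 1)" and Av: "A *\<^sub>v v = e \<cdot>\<^sub>v v"
    using A ev by (auto simp: eigenvector_def)
  have "v $ k = 0" if "k \<le> l" for k
    using that
  proof (induction k rule: less_induct)
    case (less k)
    show ?case
    proof (cases k)
      case (Suc i)
      have "e * v $ i = (\<Sum>j<l + 1. A $$ (i, j) * v $ j)"
        using arg_cong[OF Av, of "\<lambda>w. w $ i"] A v less.prems Suc
        by (simp add: scalar_prod_def atLeast0LessThan del: sum.lessThan_Suc)
      also have "\<dots> = (\<Sum>j<l + 1. if j = k then A $$ (i, k) * v $ k else 0)"
      proof (rule sum.cong[OF refl])
        fix j assume j: "j \<in> {..<l + 1}"
        consider "j < k" | "j = k" | "i + 1 < j" using Suc by linarith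
        then show "A $$ (i, j) * v $ j = (if j = k then A $$ (i, k) * v $ k else 0)"
          using j less Suc tri[of i j] by cases auto
      qed
      also have "\<dots> = A $$ (i, k) * v $ k" using less.prems by (subst sum.delta) auto
      finally show ?thesis using less Suc super[of i] by auto
    qed (use v0 in simp)
  qed
  then have "v = 0\<^sub>v (l + 1)" using v by (intro eq_vecI) auto
  then show False using v by simp
qed

section \<open>The recursion for the eigenvectors\<close>

lemma cvec_carrier:
  assumes "\<And>j. j \<in> I \<Longrightarrow> c j \<in> carrier_vec n" and "j \<in> I" and "{1..m} \<subseteq> I"
  shows "cvec lam c \<alpha> m j \<in> carrier_vec n"
  using assms(2,3)
proof (induction m arbitrary: j)
  case (Suc m)
  have "{1..m} \<subseteq> I" "Suc m \<in> I" using Suc.prems(2) by auto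
  then show ?case using Suc.IH Suc.prems(1) by simp
qed (use assms(1) in auto)

lemma cvec_cong:
  assumes "\<And>i. 1 \<le> i \<Longrightarrow> i \<le> m \<Longrightarrow> \<alpha> i = \<beta> i"
  shows "cvec lam c \<alpha> m = cvec lam c \<beta> m"
  using assms by (induction m) auto

text \<open>The \<open>i\<close>-th equation depends on \<open>\<alpha> 1, \<dots>, \<alpha> i\<close> only, so the solutions can be chosen one after
  the other.\<close>

lemma alpha_solves_cong:
  assumes "\<And>k. 1 \<le> k \<Longrightarrow> k \<le> i \<Longrightarrow> \<alpha> k = \<beta> k" and "1 \<le> i"
  shows "alpha_solves M lam c \<alpha> i \<longleftrightarrow> alpha_solves M lam c \<beta> i"
proof -
  have "cvec lam c \<alpha> (i - 1) = cvec lam c \<beta> (i - 1)"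
    by (rule cvec_cong) (use assms in auto)
  moreover have "\<alpha> i = \<beta> i" using assms by simp
  ultimately show ?thesis by (simp add: alpha_solves_def)
qed

text \<open>The first entries satisfy a recursion of their own: it is the recursion of the weights in
  \<open>secular_poly_deflate\<close>.\<close>

lemma cvec_Suc_head:
  assumes "\<And>j. j \<in> I \<Longrightarrow> c j \<in> carrier_vec n" and "0 < n"
    and "{1..Suc m} \<subseteq> I" and "j \<in> I"
  shows "cvec lam c \<alpha> (Suc m) j $ 0 = cvec lam c \<alpha> m j $ 0 +
     \<alpha> (Suc m) * cvec lam c \<alpha> m j $ 0 /
       (complex_of_real (lam j) - complex_of_real (lam (Suc m))
         - \<alpha> (Suc m) * cvec lam c \<alpha> m (Suc m) $ 0) * cvec lam c \<alpha> m (Suc m) $ 0"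
proof -
  have "cvec lam c \<alpha> m (Suc m) \<in> carrier_vec n"
    by (rule cvec_carrier[where I = I]) (use assms in auto)
  then show ?thesis using assms(2) by simp
qed

text \<open>Each step multiplies the first entry by \<open>(\<lambda>\<^sub>j - \<lambda>\<^sub>i) / (\<lambda>\<^sub>j - \<mu>)\<close>, where \<open>\<mu>\<close> is the new eigenvalue,
  and this is nonzero for distinct \<open>\<lambda>\<close>'s.\<close>

lemma cvec_head_nonzero:
  assumes c: "\<And>j. j \<in> {1..M} \<Longrightarrow> c j \<in> carrier_vec n" and n: "0 < n"
    and inj: "inj_on lam {1..M}"
    and head: "\<And>j. j \<in> {1..M} \<Longrightarrow> c j $ 0 \<noteq> 0"
    and sol: "\<And>i. i \<in> {1..m} \<Longrightarrow> alpha_solves M lam c \<alpha> i"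
    and m: "m \<le> M" and j: "j \<in> {m + 1..M}"
  shows "cvec lam c \<alpha> m j $ 0 \<noteq> 0"
  using sol m j
proof (induction m arbitrary: j)
  case 0
  then show ?case using head[of j] c[of j] n by auto
next
  case (Suc m)
  let ?d = "complex_of_real (lam j) - complex_of_real (lam (Suc m))
         - \<alpha> (Suc m) * cvec lam c \<alpha> m (Suc m) $ 0"
  have d: "?d \<noteq> 0"
    using Suc.prems(1)[of "Suc m"] Suc.prems(3) by (auto simp: alpha_solves_def)
  have "cvec lam c \<alpha> (Suc m) j $ 0 = cvec lam c \<alpha> m j $ 0 +
      \<alpha> (Suc m) * cvec lam c \<alpha> m j $ 0 / ?d * cvec lam c \<alpha> m (Suc m) $ 0"
    by (rule cvec_Suc_head[where I = "{1..M}", OF c n]) (use Suc.prems in auto)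
  also have "\<dots> = cvec lam c \<alpha> m j $ 0 *
      (?d + \<alpha> (Suc m) * cvec lam c \<alpha> m (Suc m) $ 0) / ?d"
    using d by (simp only: distrib_left add_divide_distrib) (simp add: mult_ac)
  finally have "cvec lam c \<alpha> (Suc m) j $ 0 =
      cvec lam c \<alpha> m j $ 0 * (complex_of_real (lam j) - complex_of_real (lam (Suc m))) / ?d"
    by simp
  moreover have "cvec lam c \<alpha> m j $ 0 \<noteq> 0"
    by (rule Suc.IH) (use Suc.prems in auto)
  moreover have "lam j \<noteq> lam (Suc m)"
    using inj_onD[OF inj, of j "Suc m"] Suc.prems by auto
  ultimately show ?case using d by simp
qed

lemma ex_alpha_solves:
  assumes c: "\<And>j. j \<in> {1..M} \<Longrightarrow> c j \<in> carrier_vec n" and n: "0 < n"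
    and inj: "inj_on lam {1..M}"
    and head: "\<And>j. j \<in> {1..M} \<Longrightarrow> c j $ 0 \<noteq> 0"
    and "m \<le> M"
  shows "\<exists>\<alpha>. \<forall>i\<in>{1..m}. alpha_solves M lam c \<alpha> i"
  using \<open>m \<le> M\<close>
proof (induction m)
  case (Suc m)
  then have "\<exists>\<alpha>. \<forall>i\<in>{1..m}. alpha_solves M lam c \<alpha> i" by simp
  then obtain \<alpha> where \<alpha>: "\<And>i. i \<in> {1..m} \<Longrightarrow> alpha_solves M lam c \<alpha> i" by blast
  have S: "insert (Suc m) {Suc m + 1..M} = {m + 1..M}" using Suc.prems by auto
  have "inj_on (\<lambda>j. complex_of_real (lam j)) {m + 1..M}"
    using inj_on_subset[OF inj, of "{m + 1..M}"] by (simp add: inj_on_def)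
  moreover have "cvec lam c \<alpha> m j $ 0 \<noteq> 0" if "j \<in> {m + 1..M}" for j
    using Suc.prems by (intro cvec_head_nonzero[OF c n inj head \<alpha> _ that]) simp_all
  ultimately have "\<exists>a. (\<forall>j\<in>{Suc m + 1..M}.
        complex_of_real (lam j) - complex_of_real (lam (Suc m))
          - a * cvec lam c \<alpha> m (Suc m) $ 0 \<noteq> 0) \<and>
      1 - a = a * (\<Sum>j=Suc m + 1..M. cvec lam c \<alpha> m j $ 0 /
        (complex_of_real (lam j) - complex_of_real (lam (Suc m))
          - a * cvec lam c \<alpha> m (Suc m) $ 0))"
    by (intro ex_deflating_alpha) (simp_all only: S, simp_all)
  then obtain a where a:
    "\<forall>j\<in>{Suc m + 1..M}. complex_of_real (lam j) - complex_of_real (lam (Suc m))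
        - a * cvec lam c \<alpha> m (Suc m) $ 0 \<noteq> 0"
    "1 - a = a * (\<Sum>j=Suc m + 1..M. cvec lam c \<alpha> m j $ 0 /
        (complex_of_real (lam j) - complex_of_real (lam (Suc m))
          - a * cvec lam c \<alpha> m (Suc m) $ 0))"
    by (elim exE conjE)
  define \<beta> where "\<beta> = \<alpha>(Suc m := a)"
  have cv: "cvec lam c \<beta> m = cvec lam c \<alpha> m"
    by (rule cvec_cong) (auto simp: \<beta>_def)
  have "alpha_solves M lam c \<beta> i" if "i \<in> {1..Suc m}" for i
  proof (cases "i = Suc m")
    case True
    then show ?thesis using a by (simp add: alpha_solves_def cv) (simp add: \<beta>_def)
  next
    case False
    then have "alpha_solves M lam c \<alpha> i" using \<alpha> that by auto
    then show ?thesis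
      using that False by (subst alpha_solves_cong[where \<beta> = \<alpha>]) (auto simp: \<beta>_def)
  qed
  then show ?case by blast
qed simp

text \<open>Iterated deflation: after \<open>m\<close> steps the nodes \<open>1, \<dots>, m\<close> have been traded for the new eigenvalues.
  At \<open>m = M\<close> no node is left and the secular polynomial is the product of its linear factors.\<close>

lemma secular_poly_splits:
  assumes c: "\<And>j. j \<in> {1..M} \<Longrightarrow> c j \<in> carrier_vec n" and n: "0 < n"
    and sol: "\<And>i. i \<in> {1..M} \<Longrightarrow> alpha_solves M lam c \<alpha> i"
    and "m \<le> M"
  shows "secular_poly {1..M} (\<lambda>j. complex_of_real (lam j)) (\<lambda>j. complex_of_real (c j $ 0)) =
    (\<Prod>i=1..m. [:- lam_b M lam c \<alpha> i, 1:]) *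
    secular_poly {m + 1..M} (\<lambda>j. complex_of_real (lam j)) (\<lambda>j. cvec lam c \<alpha> m j $ 0)"
  using \<open>m \<le> M\<close>
proof (induction m)
  case 0
  have "complex_of_real (c j $ 0) = cvec lam c \<alpha> 0 j $ 0" if "j \<in> {1..M}" for j
    using c[OF that] n by auto
  then show ?case by (auto intro: secular_poly_cong)
next
  case (Suc m)
  have S: "insert (Suc m) {Suc m + 1..M} = {m + 1..M}" using Suc.prems by auto
  have step: "secular_poly {m + 1..M} (\<lambda>j. complex_of_real (lam j)) (\<lambda>j. cvec lam c \<alpha> m j $ 0) =
      [:- (complex_of_real (lam (Suc m)) + \<alpha> (Suc m) * cvec lam c \<alpha> m (Suc m) $ 0), 1:] *
      secular_poly {Suc m + 1..M} (\<lambda>j. complex_of_real (lam j)) (\<lambda>j. cvec lam c \<alpha> (Suc m) j $ 0)"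
    unfolding S[symmetric]
  proof (rule secular_poly_deflate)
    fix j assume "j \<in> {Suc m + 1..M}"
    then show "cvec lam c \<alpha> (Suc m) j $ 0 = cvec lam c \<alpha> m j $ 0 +
       \<alpha> (Suc m) * cvec lam c \<alpha> m j $ 0 /
         (complex_of_real (lam j) - complex_of_real (lam (Suc m))
           - \<alpha> (Suc m) * cvec lam c \<alpha> m (Suc m) $ 0) * cvec lam c \<alpha> m (Suc m) $ 0"
      by (intro cvec_Suc_head[where I = "{1..M}", OF c n]) auto
  qed (use sol[of "Suc m"] Suc.prems in \<open>auto simp: alpha_solves_def\<close>)
  have "m \<le> M" using Suc.prems by simp
  note Suc.IH[OF this]
  also note step
  finally show ?case
    using Suc.prems by (simp add: lam_b_def mult.assoc del: mult_pCons_left mult_pCons_right)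
qed

section \<open>The eigenvalues of the perturbed matrix\<close>

theorem corollary2:
  fixes l M :: nat
    and bd bu bz :: "nat \<Rightarrow> real"
    and W B :: "real mat"
    and lam :: "nat \<Rightarrow> real"
    and c :: "nat \<Rightarrow> real vec"
  assumes b_nonneg: "\<And>i. i \<le> l \<Longrightarrow> bd i \<ge> 0 \<and> bu i \<ge> 0 \<and> bz i \<ge> 0"
    and "bd 0 > 0" and "bu l = 0"
    and bw_pos: "\<And>i. i \<le> l \<Longrightarrow> bz i + bd i + bu i > 0"
    and B_form: "B = B_matrix l bd bu bz"
    and W_dim: "W \<in> carrier_mat (l + 1) (l + 1)"
    and W_tridiagonal: "\<And>i j. i \<le> l \<Longrightarrow> j \<le> l \<Longrightarrow> i + 1 < j \<or> j + 1 < i \<Longrightarrow> W $$ (i, j) = 0"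
    and W_B: "\<And>i j. i \<le> l \<Longrightarrow> 1 \<le> j \<Longrightarrow> j \<le> l \<Longrightarrow> W $$ (i, j) = B $$ (i, j)"
    and W_offdiag: "\<And>i. 1 \<le> i \<Longrightarrow> i \<le> l \<Longrightarrow> W $$ (i, i - 1) * W $$ (i - 1, i) > 0"
    and W_diag: "\<And>i. i \<le> l \<Longrightarrow> W $$ (i, i) < 0"
    and W_eigen: "\<And>i. i \<in> {1..l+1} \<Longrightarrow> eigenvector W (c i) (lam i)"
    and lam_neg: "\<And>i. i \<in> {1..l+1} \<Longrightarrow> lam i < 0"
    and lam_distinct: "inj_on lam {1..l+1}"
    and M_le: "M \<le> l + 1"
    and B_expansion: "B = W + times_delta (vec (l + 1) (\<lambda>k. \<Sum>i=1..M. c i $ k))"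
  shows "(\<exists>\<alpha>. \<forall>i\<in>{1..M}. alpha_solves M lam c \<alpha> i) \<and>
    (\<forall>\<alpha>. (\<forall>i\<in>{1..M}. alpha_solves M lam c \<alpha> i) \<longrightarrow>
       {x. eigenvalue (map_mat complex_of_real B) x} = lam_b M lam c \<alpha> ` {1..l+1} \<and>
       char_poly (map_mat complex_of_real B) = (\<Prod>i=1..l+1. [:- lam_b M lam c \<alpha> i, 1:]))"
proof -
  let ?h = complex_of_real
  let ?B = "map_mat ?h B" and ?W = "map_mat ?h W"
  have sub: "{1..M} \<subseteq> {1..l+1}" using M_le by auto
  have c: "c j \<in> carrier_vec (l + 1)" if "j \<in> {1..l+1}" for j
    using W_eigen[OF that] W_dim by (auto simp: eigenvector_def)
  have c': "c j \<in> carrier_vec (l + 1)" if "j \<in> {1..M}" for j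
    using c that sub by blast
  have n: "0 < l + 1" by simp
  have head: "c j $ 0 \<noteq> 0" if "j \<in> {1..M}" for j
  proof (rule lower_hessenberg_eigenvector_head_nonzero[OF W_dim])
    show "W $$ (i, i + 1) \<noteq> 0" if "i < l" for i
      using W_offdiag[of "i + 1"] that by auto
    show "eigenvector W (c j) (lam j)" using W_eigen that sub by blast
  qed (use W_tridiagonal in auto)
  have inj: "inj_on lam {1..M}" using lam_distinct sub by (rule inj_on_subset)
  have ex: "\<exists>\<alpha>. \<forall>i\<in>{1..M}. alpha_solves M lam c \<alpha> i"
    using ex_alpha_solves[OF c' n inj head order_refl] .
  define v where "v = vec (l + 1) (\<lambda>k. \<Sum>i=1..M. c i $ k)"
  have B_dim: "?B \<in> carrier_mat (l + 1) (l + 1)"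
    using W_dim by (simp add: B_expansion times_delta_def)
  have "?B = ?W + times_delta (map_vec ?h v)"
    unfolding B_expansion v_def[symmetric]
    using W_dim by (intro eq_matI) (auto simp: times_delta_def v_def)
  moreover have "char_poly (?W + times_delta (map_vec ?h v)) =
      (\<Prod>k\<in>{1..l+1} - {1..M}. [:- ?h (lam k), 1:]) *
      secular_poly {1..M} (\<lambda>j. ?h (lam j)) (\<lambda>j. map_vec ?h (c j) $ 0)"
  proof (rule char_poly_first_column_perturbation[where n = "l + 1"])
    show "eigenvector ?W (map_vec ?h (c i)) (?h (lam i))" if "i \<in> {1..l+1}" for i
      using of_real_hom.eigenvector_hom[OF W_dim W_eigen[OF that]] .
    show "inj_on (\<lambda>j. ?h (lam j)) {1..l+1}"
      using lam_distinct by (simp add: inj_on_def)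
    show "map_vec ?h v $ k = (\<Sum>j=1..M. map_vec ?h (c j) $ k)" if "k < l + 1" for k
    proof -
      have "map_vec ?h (c j) $ k = ?h (c j $ k)" if "j \<in> {1..M}" for j
        using c'[OF that] \<open>k < l + 1\<close> by simp
      then show ?thesis using that by (simp add: v_def)
    qed
  qed (use W_dim sub in \<open>auto simp: v_def\<close>)
  moreover have "secular_poly {1..M} (\<lambda>j. ?h (lam j)) (\<lambda>j. map_vec ?h (c j) $ 0) =
      secular_poly {1..M} (\<lambda>j. ?h (lam j)) (\<lambda>j. ?h (c j $ 0))"
    using carrier_vecD[OF c'] by (intro secular_poly_cong) simp
  ultimately have char_B: "char_poly ?B =
      (\<Prod>k\<in>{1..l+1} - {1..M}. [:- ?h (lam k), 1:]) *
      secular_poly {1..M} (\<lambda>j. ?h (lam j)) (\<lambda>j. ?h (c j $ 0))"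
    by simp
  have "{x. eigenvalue ?B x} = lam_b M lam c \<alpha> ` {1..l+1} \<and>
      char_poly ?B = (\<Prod>i=1..l+1. [:- lam_b M lam c \<alpha> i, 1:])"
    if \<alpha>: "\<forall>i\<in>{1..M}. alpha_solves M lam c \<alpha> i" for \<alpha>
  proof -
    have "secular_poly {1..M} (\<lambda>j. ?h (lam j)) (\<lambda>j. ?h (c j $ 0)) =
        (\<Prod>i=1..M. [:- lam_b M lam c \<alpha> i, 1:])"
      using secular_poly_splits[where lam = lam and \<alpha> = \<alpha>, OF c' n _ order_refl] \<alpha> by simp
    moreover have "(\<Prod>k\<in>{1..l+1} - {1..M}. [:- ?h (lam k), 1:]) =
        (\<Prod>k\<in>{1..l+1} - {1..M}. [:- lam_b M lam c \<alpha> k, 1:])"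
      by (intro prod.cong) (auto simp: lam_b_def)
    ultimately have char: "char_poly ?B = (\<Prod>i=1..l+1. [:- lam_b M lam c \<alpha> i, 1:])"
      unfolding char_B by (simp only: prod.subset_diff[OF sub finite_atLeastAtMost])
    have "eigenvalue ?B x \<longleftrightarrow> x \<in> lam_b M lam c \<alpha> ` {1..l+1}" for x
      unfolding eigenvalue_root_char_poly[OF B_dim] char poly_prod
      by (subst prod_zero_iff) auto
    with char show ?thesis by blast
  qed
  with ex show ?thesis by blast
qed

end
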